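(* Let $$f(z)=z^n+az^k+b\overline{z}^k-1,\qquad z\in\mathbb{C},$$ where $a,b$ are positive real numbers with $|b-a|>2$ and $n,k$ are natural numbers with $n>k\ge 1$. Suppose without loss of generality that $b>a$ (that is, the case $a>b$ is also asserted, with the roles of $a$ and $b$ exchanged in the radii below). Then there exist two annuli centered at the origin such that the inner annulus, defined by radii $R_1$ and $R_2$, contains $k$ zeros of $f$ (counted with multiplicity), and the outer annulus, defined by radii $R_3$ and $R_4$, contains all remaining zeros of $f$. Moreover, the radii are given by $$R_1=\frac{1}{(b+a+1)^{1/k}},\quad R_2=\frac{1}{(b-a-1)^{1/k}},\quad R_3=(b-a-1)^{1/(n-k)},\quad R_4=(b+a+1)^{1/(n-k)}.$$
   Context: Here $f=H+\overline{G}$ with analytic part $H(z)=z^n+az^k-1$ and co-analytic part $\overline{G(z)}$, $G(z)=bz^k$. The sense-preserving region of $f$ is $\{z: |H'(z)|>|G'(z)|\}$ and the sense-reversing region is $\{z: |H'(z)|<|G'(z)|\}$. The order of a zero $z_0$ of $f$ in the sense-preserving region is the smallest $m\ge 1$ with $H^{(m)}(z_0)\ne 0$; the order of a zero $z_0$ in the sense-reversing region is $-m$, where $m\ge 1$ is the smallest integer with $G^{(m)}(z_0)\neq 0$. Such a zero is counted with multiplicity equal to the absolute value of its order. *)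

theory Defs
  imports "HOL-Analysis.Analysis"
begin

definition annulus :: "real \<Rightarrow> real \<Rightarrow> complex set" where
  "annulus r R = {z. r < norm z \<and> norm z < R}"

text \<open>
  Throughout, a harmonic function \<open>f\<close> is given with a decomposition
  \<open>f z = H z + cnj (G z)\<close> into holomorphic \<open>H\<close> and \<open>G\<close>.
\<close>

definition sense_preserving :: "(complex \<Rightarrow> complex) \<Rightarrow> (complex \<Rightarrow> complex) \<Rightarrow> complex set" where
  "sense_preserving H G = {z. norm (deriv H z) > norm (deriv G z)}"

definition sense_reversing :: "(complex \<Rightarrow> complex) \<Rightarrow> (complex \<Rightarrow> complex) \<Rightarrow> complex set" where
  "sense_reversing H G = {z. norm (deriv H z) < norm (deriv G z)}"

text \<open>
  The order is only meaningful at zeros off the singular set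
  \<open>norm (deriv H z) = norm (deriv G z)\<close>; the value \<open>0\<close> on that set is a dummy.
\<close>

definition zero_order :: "(complex \<Rightarrow> complex) \<Rightarrow> (complex \<Rightarrow> complex) \<Rightarrow> complex \<Rightarrow> int" where
  "zero_order H G z =
     (if z \<in> sense_preserving H G then int (LEAST m. 1 \<le> m \<and> (deriv ^^ m) H z \<noteq> 0)
      else if z \<in> sense_reversing H G then - int (LEAST m. 1 \<le> m \<and> (deriv ^^ m) G z \<noteq> 0)
      else 0)"

text \<open>
  \<open>f\<close> has exactly \<open>N\<close> zeros in \<open>A\<close>, counted with the absolute values of their orders.
  The second conjunct says that every zero in \<open>A\<close> has an order, so that none is
  missed by the dummy value of \<^const>\<open>zero_order\<close>.
\<close>

definition has_zeros_with_mult ::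
  "(complex \<Rightarrow> complex) \<Rightarrow> (complex \<Rightarrow> complex) \<Rightarrow> (complex \<Rightarrow> complex) \<Rightarrow> complex set \<Rightarrow> nat \<Rightarrow> bool" where
  "has_zeros_with_mult f H G A N \<longleftrightarrow>
     finite {z \<in> A. f z = 0} \<and>
     {z \<in> A. f z = 0} \<subseteq> sense_preserving H G \<union> sense_reversing H G \<and>
     (\<Sum>z | z \<in> A \<and> f z = 0. \<bar>zero_order H G z\<bar>) = int N"

end

theory Submission
  imports Defs
begin

text \<open>
  Comparing moduli in \<open>f z = 0\<close> confines the zeros in the open unit disc to the inner annulus and
  all others to the outer one. Since \<open>Re (1 - z ^ n) > 0\<close> in the disc, \<open>w = z ^ k\<close> lies in the right
  half-plane at a zero, so \<open>z = \<zeta> * w powr (1 / k)\<close> with a unique \<open>k\<close>-th root of unity \<open>\<zeta>\<close>, and \<open>f z = 0\<close>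
  turns into \<open>a * w + b * cnj w = 1 - \<zeta> ^ n * w powr \<mu>\<close> with \<open>\<mu> = n / k\<close>. For each \<open>\<zeta>\<close> this has a
  solution by Brouwer's theorem. It is unique because the left side expands distances by at
  least \<open>d = \<bar>b - a\<bar>\<close>, whereas \<open>\<mu> * norm w powr (\<mu> - 1) < d\<close> at every solution. The same slope bound
  gives \<open>norm (deriv H z) \<noteq> norm (deriv G z)\<close>, so every zero in the disc has order \<open>1\<close> or \<open>-1\<close>.
\<close>

section \<open>Estimates for the slope and for the linear part\<close>

text \<open>
  The function \<open>g t = 1 + t powr \<mu> - d * t\<close> is convex with \<open>g T \<ge> 0 > g 1\<close>, so \<open>g\<close> decreases at \<open>T\<close>.
\<close>

lemma tangent_slope_less:
  fixes T \<mu> d :: real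
  assumes "0 < T" "T < 1" "1 \<le> \<mu>" "2 < d" "d * T \<le> 1 + T powr \<mu>"
  shows "\<mu> * T powr (\<mu> - 1) < d"
proof -
  \<comment> \<open>Young's inequality for \<open>1\<close> and \<open>T powr \<mu>\<close> amounts
    to the tangent-line inequality: the tangent of \<open>t powr \<mu>\<close> at \<open>T\<close>
    lies below the curve at \<open>1\<close>.\<close>
  have "1 powr (1 / \<mu>) * (T powr \<mu>) powr (1 - 1 / \<mu>) \<le> 1 / \<mu> * 1 + (1 - 1 / \<mu>) * T powr \<mu>"
    using assms by (intro Youngs_inequality_0) auto
  also have "(T powr \<mu>) powr (1 - 1 / \<mu>) = T powr (\<mu> - 1)"
    using assms by (simp add: powr_powr right_diff_distrib)
  finally have "\<mu> * T powr (\<mu> - 1) \<le> 1 + (\<mu> - 1) * T powr \<mu>"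
    using assms by (simp add: field_simps)
  moreover have "T powr \<mu> = T powr (\<mu> - 1) * T"
    using assms by (simp add: powr_diff)
  ultimately have "T powr \<mu> + \<mu> * T powr (\<mu> - 1) * (1 - T) \<le> 1"
    by (simp add: algebra_simps)
  \<comment> \<open>Indeed \<open>1 - T powr \<mu> \<le> 2 - d * T < d * (1 - T)\<close>.\<close>
  with assms have "\<mu> * T powr (\<mu> - 1) * (1 - T) < d * (1 - T)"
    by (simp add: algebra_simps)
  then show ?thesis
    using assms by simp
qed

text \<open>The two summands have moduli \<open>a * norm w\<close> and \<open>b * norm w\<close>. By
  real linearity, taking \<open>w = u - v\<close> yields the expansion of distances.\<close>

lemma norm_add_cnj_ge:
  fixes a b :: real
  assumes "0 < a" "0 < b"
  shows "\<bar>b - a\<bar> * norm w \<le> norm (of_real a * w + of_real b * cnj w)"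
proof -
  have "\<bar>b * norm w - a * norm w\<bar> \<le> norm (of_real a * w + of_real b * cnj w)"
    using norm_triangle_ineq3[of "of_real b * cnj w" "- (of_real a * w)"] assms
    by (simp add: norm_mult add.commute)
  then show ?thesis
    by (simp add: left_diff_distrib[symmetric] abs_mult)
qed

lemma norm_add_cnj_le:
  fixes a b :: real
  assumes "0 < a" "0 < b"
  shows "norm (of_real a * w + of_real b * cnj w) \<le> (a + b) * norm w"
  using norm_triangle_ineq[of "of_real a * w" "of_real b * cnj w"] assms
  by (simp add: norm_mult algebra_simps)

section \<open>Solutions of one branch equation\<close>

lemma branch_solution_unique:
  fixes a b \<mu> :: real
  assumes "0 < a" "0 < b" "\<bar>b - a\<bar> > 2" "\<mu> \<ge> 1" "norm \<zeta> = 1"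
    and "Re u > 0" "norm u < 1" "of_real a * u + of_real b * cnj u = 1 - \<zeta> * u powr of_real \<mu>"
    and "Re v > 0" "norm v < 1" "of_real a * v + of_real b * cnj v = 1 - \<zeta> * v powr of_real \<mu>"
  shows "u = v"
proof (rule ccontr)
  assume "u \<noteq> v"
  \<comment> \<open>The slope is increasing in the modulus, so its bound at the larger solution
    controls the derivative of the power on a convex half-disc containing both.\<close>
  define T where "T = max (norm u) (norm v)"
  have slope: "\<mu> * norm w powr (\<mu> - 1) < \<bar>b - a\<bar>"
    if "Re w > 0" "norm w < 1" "of_real a * w + of_real b * cnj w = 1 - \<zeta> * w powr of_real \<mu>" for w
  proof (rule tangent_slope_less)
    show "\<bar>b - a\<bar> * norm w \<le> 1 + norm w powr \<mu>"
      using norm_add_cnj_ge[OF assms(1,2), of w] that assms(5)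
        norm_triangle_ineq4[of 1 "\<zeta> * w powr of_real \<mu>"]
      by (simp add: norm_mult norm_powr_real_powr')
    show "norm w > 0" using that by auto
  qed (use that assms in auto)
  have T: "\<mu> * T powr (\<mu> - 1) < \<bar>b - a\<bar>"
    unfolding T_def using slope[of u] slope[of v] assms by (auto simp: max_def)
  have "norm (u powr of_real \<mu> - v powr of_real \<mu>) \<le> (\<mu> * T powr (\<mu> - 1)) * norm (u - v)"
  proof (rule field_differentiable_bound)
    show "convex ({z. Re z > 0} \<inter> cball 0 T)"
      by (intro convex_Int convex_halfspace_Re_gt convex_cball)
    show "((\<lambda>z. z powr of_real \<mu>) has_field_derivative of_real \<mu> * z powr (of_real \<mu> - 1))
        (at z within {z. Re z > 0} \<inter> cball 0 T)" if "z \<in> {z. Re z > 0} \<inter> cball 0 T" for z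
      using that by (intro has_field_derivative_at_within[OF has_field_derivative_powr])
        (auto simp: complex_nonpos_Reals_iff)
    show "norm (of_real \<mu> * z powr (of_real \<mu> - 1)) \<le> \<mu> * T powr (\<mu> - 1)"
      if "z \<in> {z. Re z > 0} \<inter> cball 0 T" for z
      using that assms norm_powr_real_powr'[of "of_real (\<mu> - 1)" z]
      by (auto simp: norm_mult intro!: mult_left_mono powr_mono2)
    show "u \<in> {z. Re z > 0} \<inter> cball 0 T" "v \<in> {z. Re z > 0} \<inter> cball 0 T"
      using assms by (auto simp: T_def)
  qed
  also have "\<dots> < \<bar>b - a\<bar> * norm (u - v)"
    using T \<open>u \<noteq> v\<close> by simp
  also have "\<dots> \<le> norm (of_real a * (u - v) + of_real b * cnj (u - v))"
    by (intro norm_add_cnj_ge assms)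
  also have "of_real a * (u - v) + of_real b * cnj (u - v) = - (\<zeta> * (u powr of_real \<mu> - v powr of_real \<mu>))"
    using assms(8,11) by (simp add: algebra_simps)
  also have "norm \<dots> = norm (u powr of_real \<mu> - v powr of_real \<mu>)"
    using assms(5) by (simp add: norm_mult del: mult_minus_left mult_minus_right)
  finally show False by simp
qed

text \<open>Inverting the linear part turns the equation into a fixed-point problem for
  \<open>\<Phi>\<close>, to which Brouwer applies on a half-disc segment \<open>K\<close>.\<close>

lemma branch_solution_exists:
  fixes a b \<mu> :: real
  assumes "0 < a" "0 < b" "\<bar>b - a\<bar> > 2" "\<mu> > 0" "norm \<zeta> = 1"
  obtains w where "Re w > 0" "norm w < 1"
    "of_real a * w + of_real b * cnj w = 1 - \<zeta> * w powr of_real \<mu>"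
proof -
  \<comment> \<open>The linear part multiplies \<open>Re\<close> by \<open>a + b\<close> and
    \<open>Im\<close> by \<open>a - b\<close>; \<open>M\<close> is its inverse.\<close>
  define M where "M v = Complex (Re v / (a + b)) (Im v / (a - b))" for v
  have inv: "of_real a * M v + of_real b * cnj (M v) = v" for v
    using assms by (auto simp: M_def complex_eq_iff simp flip: add_divide_distrib diff_divide_distrib
        distrib_right left_diff_distrib)
  have norm_M: "\<bar>b - a\<bar> * norm (M v) \<le> norm v" for v
    using norm_add_cnj_ge[OF assms(1,2), of "M v"] by (simp add: inv)
  \<comment> \<open>The right side has modulus at most \<open>2\<close> and \<open>M\<close> shrinks
    by at least \<open>\<bar>b - a\<bar>\<close>.\<close>
  define \<rho> where "\<rho> = 2 / \<bar>b - a\<bar>"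
  have \<rho>: "0 < \<rho>" "\<rho> < 1" using assms by (auto simp: \<rho>_def)
  \<comment> \<open>The least real part that \<open>\<Phi>\<close> can produce; its positivity keeps
    \<open>K\<close> off the branch cut, where \<open>\<Phi>\<close> could be discontinuous.\<close>
  define \<eta> where "\<eta> = (1 - \<rho> powr \<mu>) / (a + b)"
  have "\<rho> powr \<mu> < 1" using \<rho> assms by (simp add: powr01_less_one)
  then have \<eta>: "0 < \<eta>" using assms by (simp add: \<eta>_def)
  define K where "K = {w. Re w \<ge> \<eta>} \<inter> cball 0 \<rho>"
  define \<Phi> where "\<Phi> w = M (1 - \<zeta> * w powr of_real \<mu>)" for w
  have maps: "\<Phi> w \<in> K" if "Re w > 0" "norm w \<le> \<rho>" for w
  proof -
    have le: "norm (\<zeta> * w powr of_real \<mu>) \<le> \<rho> powr \<mu>"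
      using that assms by (simp add: norm_mult norm_powr_real_powr' powr_mono2)
    have "Re (\<zeta> * w powr of_real \<mu>) \<le> norm (\<zeta> * w powr of_real \<mu>)"
      by (rule complex_Re_le_cmod)
    with le have "Re (\<Phi> w) \<ge> \<eta>"
      using assms by (simp add: \<Phi>_def M_def \<eta>_def divide_right_mono)
    moreover have "norm (1 - \<zeta> * w powr of_real \<mu>) \<le> 2"
      using norm_triangle_ineq4[of 1 "\<zeta> * w powr of_real \<mu>"] le \<open>\<rho> powr \<mu> < 1\<close> by simp
    with norm_M[of "1 - \<zeta> * w powr of_real \<mu>"] have "norm (\<Phi> w) \<le> \<rho>"
      using assms by (simp add: \<Phi>_def \<rho>_def field_simps)
    ultimately show ?thesis by (simp add: K_def)
  qed
  have "compact K" unfolding K_def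
    by (intro closed_Int_compact closed_halfspace_Re_ge compact_cball)
  moreover have "convex K" unfolding K_def
    by (intro convex_Int convex_halfspace_Re_ge convex_cball)
  moreover have "K \<noteq> {}"
    using maps[of "of_real \<rho>"] \<rho> by auto
  moreover have "continuous_on K \<Phi>"
    unfolding \<Phi>_def M_def Complex_eq
    by (intro continuous_intros) (use \<eta> assms in \<open>auto simp: K_def complex_nonpos_Reals_iff\<close>)
  moreover have "\<Phi> \<in> K \<rightarrow> K"
    using maps \<eta> by (auto simp: K_def)
  ultimately obtain w where w: "w \<in> K" "\<Phi> w = w"
    by (rule brouwer)
  show ?thesis
  proof
    show "Re w > 0" "norm w < 1" using w \<eta> \<rho> by (auto simp: K_def)
    show "of_real a * w + of_real b * cnj w = 1 - \<zeta> * w powr of_real \<mu>"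
      using inv[of "1 - \<zeta> * w powr of_real \<mu>"] w(2) by (simp add: \<Phi>_def)
  qed
qed

section \<open>Counting the zeros in the unit disc\<close>

lemma card_zeros_in_unit_disc:
  fixes a b :: real and n k :: nat
  assumes "0 < a" "0 < b" "\<bar>b - a\<bar> > 2" "k \<ge> 1" "n > k"
  defines "Z \<equiv> {z :: complex. norm z < 1 \<and> z ^ n + of_real a * z ^ k + of_real b * cnj z ^ k - 1 = 0}"
  shows "card Z = k"
proof -
  define \<mu> where "\<mu> = real n / real k"
  have \<mu>: "\<mu> > 1" using assms by (simp add: \<mu>_def)
  define p where "p w = w powr of_real (1 / real k)" for w :: complex
  have p_k: "p w ^ k = w" if "w \<noteq> 0" for w
    using that assms(4) by (simp add: p_def powr_power)
  have p_n: "p w ^ n = w powr of_real \<mu>" if "w \<noteq> 0" for w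
    using that assms(4) by (simp add: p_def \<mu>_def powr_power)
  have Re_pos: "Re (z ^ k) > 0" if "z \<in> Z" for z
  proof -
    have "norm (z ^ n) < 1"
      using that assms(4,5) by (simp add: Z_def norm_power power_less_one_iff)
    then have "Re (z ^ n) < 1"
      using complex_Re_le_cmod[of "z ^ n"] by linarith
    moreover have "Re (z ^ n + of_real a * z ^ k + of_real b * cnj (z ^ k) - 1) = 0"
      using that by (simp add: Z_def)
    ultimately have "(a + b) * Re (z ^ k) > 0"
      by (simp add: algebra_simps del: complex_cnj_power)
    then show ?thesis using assms(1,2) by (simp add: zero_less_mult_iff)
  qed
  \<comment> \<open>\<open>q z\<close> is the root of unity that selects the branch:
    \<open>z\<close> is \<open>q z\<close> times the principal root of \<open>z ^ k\<close>.
    Uniqueness on a branch makes \<open>q\<close> injective, existence makes it surjective.\<close>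
  define q where "q z = z / p (z ^ k)" for z
  have "bij_betw q Z {\<zeta>. \<zeta> ^ k = 1}"
    unfolding bij_betw_def
  proof (intro conjI)
    have q: "q z ^ k = 1" "z = q z * p (z ^ k)" "norm (z ^ k) < 1"
      "of_real a * z ^ k + of_real b * cnj (z ^ k) = 1 - q z ^ n * (z ^ k) powr of_real \<mu>"
      if "z \<in> Z" for z
    proof -
      have nz: "z ^ k \<noteq> 0" using Re_pos[OF that] by (metis less_irrefl zero_complex.simps(1))
      then have "p (z ^ k) \<noteq> 0" by (simp add: p_def)
      then show zq: "z = q z * p (z ^ k)" by (simp add: q_def)
      show "q z ^ k = 1" using nz by (simp add: q_def power_divide p_k)
      show "norm (z ^ k) < 1"
        using that assms(4) by (simp add: Z_def norm_power power_less_one_iff)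
      have "z ^ n = q z ^ n * (z ^ k) powr of_real \<mu>"
        by (subst zq) (simp only: power_mult_distrib p_n[OF nz])
      with that show "of_real a * z ^ k + of_real b * cnj (z ^ k) = 1 - q z ^ n * (z ^ k) powr of_real \<mu>"
        by (simp add: Z_def algebra_simps)
    qed
    have norm_root: "norm (\<zeta> ^ n) = 1" if "\<zeta> ^ k = 1" for \<zeta> :: complex
    proof -
      have "norm \<zeta> = 1" using that assms(4) power_eq_1_iff[of \<zeta> k] by auto
      then show ?thesis by (simp add: norm_power)
    qed
    show "inj_on q Z"
    proof (rule inj_onI)
      fix y z assume yz: "y \<in> Z" "z \<in> Z" "q y = q z"
      have "y ^ k = z ^ k"
        by (rule branch_solution_unique[of a b \<mu> "q y ^ n"])
          (use assms(1-3) \<mu> q[OF yz(1)] q[OF yz(2)] yz(3) Re_pos[OF yz(1)] Re_pos[OF yz(2)] norm_root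
            in simp_all)
      then show "y = z" using q(2)[OF yz(1)] q(2)[OF yz(2)] yz(3) by simp
    qed
    have "\<zeta> \<in> q ` Z" if \<zeta>: "\<zeta> ^ k = 1" for \<zeta>
    proof -
      obtain w where w: "Re w > 0" "norm w < 1"
        "of_real a * w + of_real b * cnj w = 1 - \<zeta> ^ n * w powr of_real \<mu>"
        using branch_solution_exists[of a b \<mu> "\<zeta> ^ n"] assms(1-3) \<mu> norm_root[OF \<zeta>] by auto
      define z where "z = \<zeta> * p w"
      have "w \<noteq> 0" using w by auto
      then have zk: "z ^ k = w" and zn: "z ^ n = \<zeta> ^ n * w powr of_real \<mu>"
        using \<zeta> by (simp_all add: z_def power_mult_distrib p_k p_n)
      have "norm z ^ k < 1" using w(2) zk by (metis norm_power)
      then have "norm z < 1" using assms(4) by (simp add: power_less_one_iff)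
      moreover have "cnj z ^ k = cnj w" using zk by (metis complex_cnj_power)
      ultimately have "z \<in> Z" using w(3) by (simp add: Z_def zk zn algebra_simps)
      moreover have "q z = \<zeta>"
        using \<open>w \<noteq> 0\<close> zk by (simp add: q_def z_def p_def)
      ultimately show ?thesis by blast
    qed
    then show "q ` Z = {\<zeta>. \<zeta> ^ k = 1}" using q(1) by auto
  qed
  then have "card Z = card {\<zeta> :: complex. \<zeta> ^ k = 1}"
    by (rule bij_betw_same_card)
  also have "\<dots> = k"
    using assms(4) by (intro card_roots_unity_eq) auto
  finally show ?thesis .
qed

section \<open>Orders, radii and the final count\<close>

text \<open>The larger of the two derivatives cannot vanish, so the least \<open>m\<close> is
  already \<open>1\<close>.\<close>

lemma abs_zero_order_eq_1:
  assumes "norm (deriv H z) \<noteq> norm (deriv G z)"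
  shows "\<bar>zero_order H G z\<bar> = 1"
proof -
  have 1: "(LEAST m. 1 \<le> m \<and> (deriv ^^ m) F z \<noteq> 0) = 1" if "deriv F z \<noteq> 0" for F
    by (rule Least_equality) (use that in auto)
  show ?thesis
    using assms by (cases "norm (deriv H z) > norm (deriv G z)")
      (auto simp: zero_order_def sense_preserving_def sense_reversing_def simp del: One_nat_def intro!: 1)
qed

lemma less_powr_inverse_iffs:
  fixes r c :: real
  assumes "0 \<le> r" "0 < c" "0 < m"
  shows "r < c powr (1 / real m) \<longleftrightarrow> r ^ m < c"
    and "c powr (1 / real m) < r \<longleftrightarrow> c < r ^ m"
proof -
  have c: "(c powr (1 / real m)) ^ m = c" using assms by (simp add: powr_power)
  show "r < c powr (1 / real m) \<longleftrightarrow> r ^ m < c"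
    using power_mono_iff[of "c powr (1 / real m)" r m] assms c by (metis linorder_not_le powr_ge_zero)
  show "c powr (1 / real m) < r \<longleftrightarrow> c < r ^ m"
    using power_mono_iff[of r "c powr (1 / real m)" m] assms c by (metis linorder_not_le powr_ge_zero)
qed

theorem theorem1p3:
  fixes a b :: real and n k :: nat and f H G :: "complex \<Rightarrow> complex"
  assumes "a > 0" and "b > 0" and "\<bar>b - a\<bar> > 2" and "k \<ge> 1" and "n > k"
    and f: "\<And>z. f z = z ^ n + of_real a * z ^ k + of_real b * cnj z ^ k - 1"
    and H: "\<And>z. H z = z ^ n + of_real a * z ^ k - 1"
    and G: "\<And>z. G z = of_real b * z ^ k"
  shows "\<exists>R1 R2 R3 R4 :: real.
      (b > a \<longrightarrow>
         R1 = 1 / (b + a + 1) powr (1 / real k) \<and>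
         R2 = 1 / (b - a - 1) powr (1 / real k) \<and>
         R3 = (b - a - 1) powr (1 / real (n - k)) \<and>
         R4 = (b + a + 1) powr (1 / real (n - k))) \<and>
      (a > b \<longrightarrow>
         R1 = 1 / (a + b + 1) powr (1 / real k) \<and>
         R2 = 1 / (a - b - 1) powr (1 / real k) \<and>
         R3 = (a - b - 1) powr (1 / real (n - k)) \<and>
         R4 = (a + b + 1) powr (1 / real (n - k))) \<and>
      0 < R1 \<and> R1 < R2 \<and> R2 < R3 \<and> R3 < R4 \<and>
      has_zeros_with_mult f H G (annulus R1 R2) k \<and>
      (\<forall>z. f z = 0 \<and> z \<notin> annulus R1 R2 \<longrightarrow> z \<in> annulus R3 R4)"
proof -
  \<comment> \<open>With \<open>d\<close> and \<open>s\<close> the cases \<open>b > a\<close> and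
    \<open>a > b\<close> are treated at once.\<close>
  define d where "d = \<bar>b - a\<bar>"
  define s where "s = a + b"
  have d: "d > 2" "d < s" using assms by (auto simp: d_def s_def)
  define R1 where "R1 = (1 / (s + 1)) powr (1 / real k)"
  define R2 where "R2 = (1 / (d - 1)) powr (1 / real k)"
  define R3 where "R3 = (d - 1) powr (1 / real (n - k))"
  define R4 where "R4 = (s + 1) powr (1 / real (n - k))"
  have R_eq: "R1 = 1 / (s + 1) powr (1 / real k)" "R2 = 1 / (d - 1) powr (1 / real k)"
    using d by (simp_all add: R1_def R2_def powr_divide)
  \<comment> \<open>Since \<open>d - 1 > 1\<close>, the unit circle separates the two
    annuli.\<close>
  have R: "0 < R1" "R1 < R2" "R2 < 1" "1 < R3" "R3 < R4"
    using d assms unfolding R1_def R2_def R3_def R4_def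
    by (auto intro!: powr_less_mono2 gr_one_powr simp: frac_less2 powr01_less_one)
  have nk: "z ^ n = z ^ k * z ^ (n - k)" for z :: "'a :: monoid_mult"
    using assms(5) by (simp add: power_add[symmetric])
  have bounds: "norm z \<noteq> 0" "d * norm z ^ k \<le> 1 + norm z ^ n" "1 \<le> norm z ^ n + s * norm z ^ k"
    "norm z ^ n \<le> 1 + s * norm z ^ k" if "f z = 0" for z
  proof -
    show "norm z \<noteq> 0" using that assms(4,5) by (auto simp: f power_0_left)
    define l where "l = of_real a * z ^ k + of_real b * cnj (z ^ k)"
    have eq: "l = 1 - z ^ n" "z ^ n = 1 - l" "1 = z ^ n + l"
      using that by (simp_all add: l_def f algebra_simps)
    have l: "d * norm z ^ k \<le> norm l" "norm l \<le> s * norm z ^ k"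
      using norm_add_cnj_ge[OF assms(1,2), of "z ^ k"] norm_add_cnj_le[OF assms(1,2), of "z ^ k"]
      unfolding l_def d_def s_def by (simp_all add: norm_power)
    show "d * norm z ^ k \<le> 1 + norm z ^ n"
      using l(1) norm_triangle_ineq4[of 1 "z ^ n"] eq(1) by (simp add: norm_power)
    show "norm z ^ n \<le> 1 + s * norm z ^ k"
      using l(2) norm_triangle_ineq4[of 1 l] eq(2) by (simp add: norm_power[symmetric])
    show "1 \<le> norm z ^ n + s * norm z ^ k"
      using l(2) norm_triangle_ineq[of "z ^ n" l] eq(3) by (simp add: norm_power)
  qed
  have inner: "z \<in> annulus R1 R2" if z: "f z = 0" "norm z < 1" for z
  proof -
    define r where "r = norm z"
    have r: "0 < r" "r < 1" using z bounds(1)[OF z(1)] by (auto simp: r_def)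
    \<comment> \<open>Inside the disc \<open>r ^ n\<close> is absorbed into \<open>r ^ k\<close>,
      which turns \<open>s\<close> into \<open>s + 1\<close> and \<open>d\<close> into
      \<open>d - 1\<close>.\<close>
    have "r ^ n < r ^ k" using r assms(5) by (simp add: power_strict_decreasing)
    then have "1 < (s + 1) * r ^ k" "(d - 1) * r ^ k < 1"
      using bounds(2,3)[OF z(1)] unfolding r_def by (simp_all add: algebra_simps)
    then have "1 / (s + 1) < r ^ k" "r ^ k < 1 / (d - 1)"
      using d by (simp_all add: field_simps)
    then show ?thesis
      unfolding annulus_def R1_def R2_def using r d assms(4)
      by (simp add: less_powr_inverse_iffs del: of_nat_diff flip: r_def)
  qed
  have outer: "z \<in> annulus R3 R4" if z: "f z = 0" "\<not> norm z < 1" for z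
  proof -
    define r where "r = norm z"
    \<comment> \<open>On the unit circle the lower bound would read
      \<open>d \<le> 2\<close>.\<close>
    have "r \<noteq> 1"
      using bounds(2)[OF z(1)] d by (auto simp: r_def)
    then have r: "r > 1" using z by (auto simp: r_def)
    then have rk: "1 < r ^ k" using assms(4) by simp
    \<comment> \<open>Now the constant \<open>1\<close> is absorbed into \<open>r ^ k\<close>, which
      then cancels.\<close>
    have "(d - 1) * r ^ k < r ^ k * r ^ (n - k)" "r ^ k * r ^ (n - k) < (s + 1) * r ^ k"
      using bounds(2,4)[OF z(1)] rk by (simp_all add: algebra_simps nk[symmetric] flip: r_def)
    then have "d - 1 < r ^ (n - k)" "r ^ (n - k) < s + 1"
      using rk by (simp_all add: mult.commute)
    then show ?thesis
      unfolding annulus_def R3_def R4_def using r d assms(5)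
      by (simp add: less_powr_inverse_iffs del: of_nat_diff flip: r_def)
  qed
  have Z: "{z \<in> annulus R1 R2. f z = 0} = {z. norm z < 1 \<and> f z = 0}"
    using inner R(3) by (auto simp: annulus_def)
  have card: "card {z. norm z < 1 \<and> f z = 0} = k"
    unfolding f by (rule card_zeros_in_unit_disc) (use assms(1-5) in auto)
  have nonsing: "norm (deriv H z) \<noteq> norm (deriv G z)" if z: "f z = 0" "norm z < 1" for z
  proof -
    define r where "r = norm z"
    have r: "0 < r" "r < 1" using z bounds(1)[OF z(1)] by (auto simp: r_def)
    define \<mu> where "\<mu> = real n / real k"
    have pow: "(r ^ k) powr \<mu> = r ^ n" "(r ^ k) powr (\<mu> - 1) = r ^ (n - k)"
      using r assms(4,5) unfolding \<mu>_def powr_realpow[OF r(1), symmetric] powr_powr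
      by (simp_all add: right_diff_distrib of_nat_diff)
    \<comment> \<open>The slope bound is used at \<open>T = r ^ k\<close>, the modulus of
      \<open>w = z ^ k\<close>.\<close>
    have "\<mu> * (r ^ k) powr (\<mu> - 1) < d"
    proof (rule tangent_slope_less)
      show "d * r ^ k \<le> 1 + (r ^ k) powr \<mu>"
        unfolding pow unfolding r_def by (rule bounds(2)[OF z(1)])
      show "1 \<le> \<mu>" using assms(4,5) by (simp add: \<mu>_def)
    qed (use r d assms(4) in \<open>simp_all add: power_less_one_iff\<close>)
    then have slope: "real n * r ^ (n - k) < real k * d"
      using assms(4) by (simp add: pow) (simp add: \<mu>_def field_simps)
    have dG: "deriv G z = of_real b * (of_nat k * z ^ (k - 1))"
      unfolding G[abs_def] by (rule DERIV_imp_deriv) (auto intro!: derivative_eq_intros)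
    have "deriv H z = of_nat n * z ^ (n - 1) + of_real a * (of_nat k * z ^ (k - 1))"
      unfolding H[abs_def] by (rule DERIV_imp_deriv) (auto intro!: derivative_eq_intros)
    also have "z ^ (n - 1) = z ^ (k - 1) * z ^ (n - k)"
      using assms(4,5) by (simp add: power_add[symmetric])
    finally have dH: "deriv H z = z ^ (k - 1) * (of_nat n * z ^ (n - k) + of_real (a * real k))"
      by (simp add: algebra_simps)
    define u where "u = of_nat n * z ^ (n - k)"
    have u: "norm u < real k * d"
      using slope by (simp add: u_def norm_mult norm_power r_def)
    \<comment> \<open>After cancelling \<open>z ^ (k - 1)\<close>, equal derivative moduli would
      force \<open>norm u\<close> to be at least \<open>real k * d\<close>.\<close>
    have "norm (u + of_real (a * real k)) \<noteq> b * real k"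
    proof
      assume eq: "norm (u + of_real (a * real k)) = b * real k"
      have "real k * d = \<bar>b * real k - a * real k\<bar>"
        by (simp add: d_def left_diff_distrib[symmetric] abs_mult)
      also have "\<dots> \<le> norm u"
        using norm_triangle_ineq3[of "u + of_real (a * real k)" "of_real (a * real k)"] assms(1) eq
        by (simp add: norm_mult)
      finally show False using u by simp
    qed
    then show ?thesis
      using r assms(2) unfolding dG dH u_def[symmetric]
      by (auto simp: norm_mult norm_power r_def)
  qed
  have "has_zeros_with_mult f H G (annulus R1 R2) k"
    unfolding has_zeros_with_mult_def
  proof (intro conjI)
    show "finite {z \<in> annulus R1 R2. f z = 0}"
      \<comment> \<open>An infinite set has \<open>card\<close> equal to \<open>0\<close>, so
        \<open>card = k \<ge> 1\<close> yields finiteness.\<close>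
      using card assms(4) by (intro card_ge_0_finite) (simp add: Z)
    show "{z \<in> annulus R1 R2. f z = 0} \<subseteq> sense_preserving H G \<union> sense_reversing H G"
      unfolding Z using nonsing by (force simp: sense_preserving_def sense_reversing_def)
    have "(\<Sum>z | z \<in> annulus R1 R2 \<and> f z = 0. \<bar>zero_order H G z\<bar>)
        = (\<Sum>z | norm z < 1 \<and> f z = 0. 1)"
      unfolding Z by (rule sum.cong) (simp_all add: abs_zero_order_eq_1 nonsing)
    then show "(\<Sum>z | z \<in> annulus R1 R2 \<and> f z = 0. \<bar>zero_order H G z\<bar>) = int k"
      using card by simp
  qed
  then show ?thesis
    using R R_eq inner outer
    by (intro exI[of _ R1] exI[of _ R2] exI[of _ R3] exI[of _ R4])
      (auto simp: d_def s_def R3_def R4_def add.commute)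
qed

end
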